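(* For every bipartite graph $G=(U,V,E)$, \[\operatorname{fp}(G)\le \min\big(\operatorname{width}(\mathcal P_U),\operatorname{width}(\mathcal P_V)\big).\]
   Context: All graphs are finite and simple. A bipartite graph is a Ferrers graph if it contains no induced copy of $2K_2$ (two disjoint edges with no other edges among their four endpoints); equivalently, the neighborhoods on one side are totally ordered by inclusion. For a bipartite graph $G=(U,V,E)$, $\operatorname{fp}(G)$ is the minimum $k$ such that $E$ can be partitioned as $E=E_1\,\dot\cup\cdots\dot\cup\,E_k$ with each spanning subgraph $(U,V,E_i)$ a Ferrers graph. $\mathcal P_U$ is the neighborhood-inclusion poset on $U$: $u\preceq u'$ iff $N(u)\subseteq N(u')$, and $\operatorname{width}(\mathcal P_U)$ is the maximum size of an antichain, i.e. the maximum number of pairwise inclusion-incomparable sets in the family $\{N(u):u\in U\}$ (multiplicities of equal neighborhoods do not matter). $\mathcal P_V$ and $\operatorname{width}(\mathcal P_V)$ are defined symmetrically using neighborhoods of vertices in $V$. *)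

theory Defs
  imports Main "HOL-Library.Disjoint_Sets"
begin

text \<open>Graphs are represented by their sets of edges, an edge being a two-element set of
  vertices.  A bipartite graph comes with its bipartition; the vertex set is \<open>U \<union> V\<close>.\<close>

definition bipartite_graph :: "'a set \<Rightarrow> 'a set \<Rightarrow> 'a set set \<Rightarrow> bool" where
  "bipartite_graph U V E \<longleftrightarrow>
     finite U \<and> finite V \<and> U \<inter> V = {} \<and> E \<subseteq> {{u, v} | u v. u \<in> U \<and> v \<in> V}"

definition nbhd :: "'a set set \<Rightarrow> 'a \<Rightarrow> 'a set" where
  "nbhd E x = {y. {x, y} \<in> E}"

definition has_induced_2K2 :: "'a set set \<Rightarrow> bool" where
  "has_induced_2K2 E \<longleftrightarrow>
     (\<exists>e\<in>E. \<exists>f\<in>E. e \<inter> f = {} \<and> (\<forall>g\<in>E. g \<subseteq> e \<union> f \<longrightarrow> g = e \<or> g = f))"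

definition ferrers_graph :: "'a set \<Rightarrow> 'a set \<Rightarrow> 'a set set \<Rightarrow> bool" where
  "ferrers_graph U V E \<longleftrightarrow> bipartite_graph U V E \<and> \<not> has_induced_2K2 E"

text \<open>Empty parts and \<open>k = 0\<close> are allowed, so an edgeless graph has \<open>fp = 0\<close>.
  Allowing empty parts does not affect the minimum.\<close>

definition ferrers_partition ::
    "'a set \<Rightarrow> 'a set \<Rightarrow> 'a set set \<Rightarrow> nat \<Rightarrow> (nat \<Rightarrow> 'a set set) \<Rightarrow> bool" where
  "ferrers_partition U V E k F \<longleftrightarrow>
     (\<Union>i<k. F i) = E \<and> disjoint_family_on F {..<k} \<and> (\<forall>i<k. ferrers_graph U V (F i))"

definition fp :: "'a set \<Rightarrow> 'a set \<Rightarrow> 'a set set \<Rightarrow> nat" where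
  "fp U V E = (LEAST k. \<exists>F. ferrers_partition U V E k F)"

definition nbhd_le :: "'a set set \<Rightarrow> 'a \<Rightarrow> 'a \<Rightarrow> bool" where
  "nbhd_le E x y \<longleftrightarrow> nbhd E x \<subseteq> nbhd E y"

definition antichain_on :: "'a set \<Rightarrow> ('a \<Rightarrow> 'a \<Rightarrow> bool) \<Rightarrow> 'a set \<Rightarrow> bool" where
  "antichain_on S le A \<longleftrightarrow> A \<subseteq> S \<and> pairwise (\<lambda>x y. \<not> le x y \<and> \<not> le y x) A"

definition width :: "'a set \<Rightarrow> ('a \<Rightarrow> 'a \<Rightarrow> bool) \<Rightarrow> nat" where
  "width S le = Max (card ` {A. antichain_on S le A})"

text \<open>The relation \<open>nbhd_le\<close> is only a preorder when vertices have equal neighborhoods, but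
  such vertices are comparable, so its width is that of the family of neighborhoods.\<close>

lemma width_nbhd_le: "width S (nbhd_le E) = width (nbhd E ` S) (\<subseteq>)"
proof -
  have "card ` {A. antichain_on S (nbhd_le E) A} = card ` {B. antichain_on (nbhd E ` S) (\<subseteq>) B}"
  proof (intro subset_antisym subsetI)
    fix n assume "n \<in> card ` {A. antichain_on S (nbhd_le E) A}"
    then obtain A where A: "antichain_on S (nbhd_le E) A" "n = card A"
      by blast
    have "inj_on (nbhd E) A"
      using A(1) by (auto simp: antichain_on_def nbhd_le_def pairwise_def inj_on_def)
    moreover have "antichain_on (nbhd E ` S) (\<subseteq>) (nbhd E ` A)"
      using A(1) by (auto simp: antichain_on_def nbhd_le_def pairwise_def)
    ultimately show "n \<in> card ` {B. antichain_on (nbhd E ` S) (\<subseteq>) B}"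
      using A(2) by (metis card_image image_eqI mem_Collect_eq)
  next
    fix n assume "n \<in> card ` {B. antichain_on (nbhd E ` S) (\<subseteq>) B}"
    then obtain B where B: "antichain_on (nbhd E ` S) (\<subseteq>) B" "n = card B"
      by blast
    then obtain A where A: "A \<subseteq> S" "inj_on (nbhd E) A" "B = nbhd E ` A"
      by (metis antichain_on_def subset_image_inj)
    have "antichain_on S (nbhd_le E) A"
      unfolding antichain_on_def nbhd_le_def pairwise_def
    proof (intro conjI ballI impI A(1))
      fix x y assume xy: "x \<in> A" "y \<in> A" "x \<noteq> y"
      then have "nbhd E x \<noteq> nbhd E y"
        using A(2) by (auto dest: inj_onD)
      then show "\<not> nbhd E x \<subseteq> nbhd E y" "\<not> nbhd E y \<subseteq> nbhd E x"
        using B(1) xy A(3) by (auto simp: antichain_on_def pairwise_def)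
    qed
    then show "n \<in> card ` {A. antichain_on S (nbhd_le E) A}"
      using A B(2) by (auto simp: card_image)
  qed
  then show ?thesis
    by (simp add: width_def)
qed

lemma ferrers_partition_exists:
  assumes "bipartite_graph U V E"
  shows "\<exists>k F. ferrers_partition U V E k F"
proof -
  have "E \<subseteq> Pow (U \<union> V)"
    using assms by (auto simp: bipartite_graph_def)
  then have "finite E"
    using assms by (meson bipartite_graph_def finite_Pow_iff finite_UnI finite_subset)
  then obtain h where h: "bij_betw h {..<card E} E"
    using ex_bij_betw_nat_finite lessThan_atLeast0 by metis
  let ?F = "\<lambda>i. {h i}"
  have "{} \<notin> E"
    using assms by (auto simp: bipartite_graph_def)
  then have "ferrers_graph U V {e}" if "e \<in> E" for e
    using assms that
    by (auto simp: ferrers_graph_def bipartite_graph_def has_induced_2K2_def)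
  moreover have "(\<Union>i<card E. ?F i) = E"
    using h by (auto simp: bij_betw_def)
  moreover have "disjoint_family_on ?F {..<card E}"
    using h by (auto simp: bij_betw_def disjoint_family_on_def inj_on_def)
  ultimately have "ferrers_partition U V E (card E) ?F"
    using h by (auto simp: ferrers_partition_def bij_betw_def)
  then show ?thesis by blast
qed

end

theory Submission
  imports Defs
begin

text \<open>If \<open>C \<subseteq> U\<close> is a chain for neighborhood inclusion, then the edges meeting \<open>C\<close> form a
  Ferrers graph, so a colouring of \<open>U\<close> into \<open>k\<close> chains yields a Ferrers partition with \<open>k\<close>
  parts.  Dilworth's theorem, proved by Galvin's induction, provides such a colouring with
  \<open>k\<close> the width.\<close>

section \<open>Dilworth's theorem for finite preorders\<close>

lemma finite_preorder_maximal:
  assumes "finite S" "S \<noteq> {}" and tr: "\<And>x y z. le x y \<Longrightarrow> le y z \<Longrightarrow> le x z"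
  shows "\<exists>a\<in>S. \<forall>x\<in>S. le a x \<longrightarrow> le x a"
  using assms(1,2)
proof (induction S rule: finite_ne_induct)
  case (singleton x)
  then show ?case by blast
next
  case (insert x F)
  then obtain a where "a \<in> F" "\<forall>x\<in>F. le a x \<longrightarrow> le x a"
    by blast
  \<comment> \<open>If \<open>le a x\<close>, then \<open>x\<close> is maximal: anything above
    \<open>x\<close> is above \<open>a\<close>, hence below \<open>a\<close> and so below
    \<open>x\<close>. Otherwise \<open>a\<close> stays maximal.\<close>
  then show ?case
    by (metis insert_iff tr)
qed

text \<open>Comparability within colour classes makes \<open>c\<close> injective on an antichain, so
  pigeonhole applies. The equality case is what the induction uses: an antichain of size
  \<open>k\<close> meets every colour class.\<close>

lemma antichain_colouring_bound:
  assumes "antichain_on S le A" "finite S" and c: "c ` S \<subseteq> {..<k}"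
    and chain: "\<And>x y. x \<in> S \<Longrightarrow> y \<in> S \<Longrightarrow> c x = c y \<Longrightarrow> le x y \<or> le y x"
  shows "card A \<le> k" and "card A = k \<Longrightarrow> c ` A = {..<k}"
proof -
  have A: "A \<subseteq> S" "inj_on c A"
    using assms(1) chain unfolding antichain_on_def pairwise_def inj_on_def by blast+
  then have sub: "c ` A \<subseteq> {..<k}"
    using c by blast
  show "card A \<le> k"
    using card_inj_on_le[OF A(2) sub] by simp
  assume "card A = k"
  then show "c ` A = {..<k}"
    using sub A(2) by (intro card_subset_eq) (auto simp: card_image)
qed

text \<open>Stated for preorders because vertices may share a neighborhood. Taking the number of
  colours to be the size of an antichain \<open>A\<close> expresses the min-max equality without
  naming the width.\<close>

theorem dilworth:
  fixes le :: "'a \<Rightarrow> 'a \<Rightarrow> bool"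
  assumes "finite S" and re: "\<And>x. le x x" and tr: "\<And>x y z. le x y \<Longrightarrow> le y z \<Longrightarrow> le x z"
  shows "\<exists>A (c :: 'a \<Rightarrow> nat). antichain_on S le A \<and> c ` S \<subseteq> {..<card A} \<and>
           (\<forall>x\<in>S. \<forall>y\<in>S. c x = c y \<longrightarrow> le x y \<or> le y x)"
  using assms(1)
proof (induction S rule: finite_psubset_induct)
  case (psubset S)
  show ?case
  proof (cases "S = {}")
    case True
    then show ?thesis
      by (auto simp: antichain_on_def intro: exI[of _ "{}"])
  next
    case False
    obtain a where a: "a \<in> S" "\<And>x. x \<in> S \<Longrightarrow> le a x \<Longrightarrow> le x a"
      using finite_preorder_maximal[of S le] psubset.hyps False tr by metis
    define P where "P = S - {a}"
    have P: "P \<subset> S" "finite P" "a \<notin> P" "S = insert a P"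
      using a(1) psubset.hyps by (auto simp: P_def)
    obtain A0 c where A0: "antichain_on P le A0" and c: "c ` P \<subseteq> {..<card A0}"
      and chain: "\<And>x y. x \<in> P \<Longrightarrow> y \<in> P \<Longrightarrow> c x = c y \<Longrightarrow> le x y \<or> le y x"
      using psubset.IH[OF P(1)] by (metis (no_types))
    define k where "k = card A0"
    note c = c[folded k_def]
    have bound: "card B \<le> k" "card B = k \<Longrightarrow> c ` B = {..<k}" if "antichain_on P le B" for B
      using antichain_colouring_bound[OF that P(2) c] chain by blast+
    \<comment> \<open>By \<open>bound\<close>, \<open>k\<close> is the largest antichain size in
      \<open>P\<close>. \<open>X i\<close> collects the elements of colour \<open>i\<close> that lie
      on some antichain of that size.\<close>
    define X where "X i = {x \<in> P. c x = i \<and> (\<exists>B. antichain_on P le B \<and> card B = k \<and> x \<in> B)}" for i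
    have meets: "\<exists>y\<in>B. y \<in> X i" if "antichain_on P le B" "card B = k" "i < k" for B i
    proof -
      have "i \<in> c ` B"
        using bound(2) that by simp
      then obtain y where "y \<in> B" "c y = i"
        by blast
      then show ?thesis
        using that by (auto simp: X_def antichain_on_def)
    qed
    \<comment> \<open>\<open>X i\<close> lies in one colour class, so it is a chain, and a maximal
      element of it is above all the others.\<close>
    have "\<exists>x\<in>X i. \<forall>z\<in>X i. le z x" if "i < k" for i
    proof -
      have "finite (X i)" "X i \<noteq> {}"
        using P(2) meets[OF A0 _ that] by (auto simp: X_def k_def)
      then obtain x where "x \<in> X i" "\<forall>z\<in>X i. le x z \<longrightarrow> le z x"
        using finite_preorder_maximal[of "X i" le] tr by metis
      moreover have "le x z \<or> le z x" if "z \<in> X i" for z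
        using chain \<open>x \<in> X i\<close> that by (auto simp: X_def)
      ultimately show ?thesis
        by blast
    qed
    then obtain x where x: "\<And>i. i < k \<Longrightarrow> x i \<in> X i"
      and top: "\<And>i z. i < k \<Longrightarrow> z \<in> X i \<Longrightarrow> le z (x i)"
      by metis
    have cx: "c (x i) = i" "x i \<in> P" if "i < k" for i
      using x[OF that] by (auto simp: X_def)
    define A where "A = x ` {..<k}"
    have "inj_on x {..<k}"
      using cx by (metis inj_on_inverseI lessThan_iff)
    then have cardA: "card A = k"
      by (simp add: A_def card_image)
    have incomparable: "\<not> le (x i) (x j)" if ij: "i < k" "j < k" "i \<noteq> j" for i j
    proof
      assume le: "le (x i) (x j)"
      \<comment> \<open>A maximum antichain \<open>B\<close> through \<open>x j\<close> also
        contains some \<open>y\<close> in \<open>X i\<close>. As \<open>y\<close> is below the top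
        \<open>x i\<close>, it would be below \<open>x j\<close>, although both lie in
        \<open>B\<close>.\<close>
      obtain B where B: "antichain_on P le B" "card B = k" "x j \<in> B"
        using x[OF ij(2)] by (auto simp: X_def)
      obtain y where y: "y \<in> B" "y \<in> X i"
        using meets B ij by blast
      then have "le y (x j)"
        using le top tr ij by blast
      moreover have "y \<noteq> x j"
        using y cx ij by (auto simp: X_def)
      ultimately show False
        using B y by (auto simp: antichain_on_def pairwise_def)
    qed
    have A: "antichain_on P le A"
      using cx incomparable by (auto simp: A_def antichain_on_def pairwise_def)
    show ?thesis
    proof (cases "\<exists>i<k. le (x i) a")
      case False
      \<comment> \<open>By maximality of \<open>a\<close>, \<open>le a (x i)\<close> would imply
        \<open>le (x i) a\<close>, so \<open>a\<close> is incomparable to all of \<open>A\<close>.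
        Hence the antichain grows by one and \<open>a\<close> gets the fresh colour
        \<open>k\<close>.\<close>
      have "\<not> le z a \<and> \<not> le a z" if "z \<in> A" for z
        using False that a(2) cx P(4) by (auto simp: A_def)
      then have "antichain_on S le (insert a A)"
        using A P(4) by (auto simp: antichain_on_def pairwise_insert)
      moreover have "card (insert a A) = Suc k"
        using cardA cx P(3) by (subst card_insert_disjoint) (auto simp: A_def)
      moreover have "(c(a := k)) ` S \<subseteq> {..<Suc k}"
        using c P(3,4) by (fastforce simp: less_Suc_eq)
      moreover have "\<forall>u\<in>S. \<forall>v\<in>S. (c(a := k)) u = (c(a := k)) v \<longrightarrow> le u v \<or> le v u"
      proof (intro ballI impI)
        fix u v assume uv: "u \<in> S" "v \<in> S" "(c(a := k)) u = (c(a := k)) v"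
        have "c z \<noteq> k" if "z \<in> P" for z
          using c that by auto
        then have "u = a \<and> v = a \<or> u \<in> P \<and> v \<in> P \<and> c u = c v"
          using uv P(4) by (auto split: if_splits)
        then show "le u v \<or> le v u"
          using chain re by blast
      qed
      ultimately show ?thesis
        by metis
    next
      case True
      then obtain i where i: "i < k" "le (x i) a"
        by blast
      \<comment> \<open>Every antichain of size \<open>k\<close> in \<open>P\<close> meets the chain \<open>K\<close>, so removing \<open>K\<close> lowers the width.\<close>
      define K where "K = insert a {z \<in> P. c z = i \<and> le z (x i)}"
      have "S - K \<subset> S" "S - K \<subseteq> P"
        using a(1) by (auto simp: K_def P_def)
      obtain B d where B: "antichain_on (S - K) le B" and d: "d ` (S - K) \<subseteq> {..<card B}"
        and chain': "\<forall>u\<in>S-K. \<forall>v\<in>S-K. d u = d v \<longrightarrow> le u v \<or> le v u"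
        using psubset.IH[OF \<open>S - K \<subset> S\<close>] by (metis (no_types))
      have BP: "antichain_on P le B"
        using B \<open>S - K \<subseteq> P\<close> by (auto simp: antichain_on_def)
      \<comment> \<open>An antichain of size \<open>k\<close> would have an element in
        \<open>X i\<close>, which lies below the top \<open>x i\<close> and hence in
        \<open>K\<close>; but \<open>B\<close> avoids \<open>K\<close>.\<close>
      have "card B \<noteq> k"
      proof
        assume "card B = k"
        then obtain y where y: "y \<in> B" "y \<in> X i"
          using meets[OF BP] i(1) by blast
        then have "y \<in> K"
          using top[OF i(1)] by (auto simp: K_def X_def)
        then show False
          using B y by (auto simp: antichain_on_def)
      qed
      then have lt: "card B < k"
        using bound(1)[OF BP] by simp
      \<comment> \<open>\<open>d\<close> uses only colours below \<open>card B\<close>, so the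
        colour \<open>card B\<close> is free for the chain \<open>K\<close>. Since
        \<open>card B < k\<close>, all colours stay below \<open>k\<close>, matching the antichain
        \<open>A\<close> already found in \<open>P\<close>.\<close>
      define e where "e z = (if z \<in> K then card B else d z)" for z
      have below: "le z a" if "z \<in> K" for z
      proof -
        have "z = a \<or> le z (x i)"
          using that by (auto simp: K_def)
        then show ?thesis
          using re tr[OF _ i(2), of z] by blast
      qed
      have Kchain: "le u v \<or> le v u" if "u \<in> K" "v \<in> K" for u v
      proof -
        have "u = a \<or> v = a \<or> u \<in> P \<and> v \<in> P \<and> c u = c v"
          using that by (auto simp: K_def)
        then show ?thesis
          using that below chain by blast
      qed
      have "antichain_on S le A"
        using A P(1) by (auto simp: antichain_on_def)
      moreover have "e ` S \<subseteq> {..<card A}"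
        using d lt cardA by (fastforce simp: e_def)
      moreover have "\<forall>u\<in>S. \<forall>v\<in>S. e u = e v \<longrightarrow> le u v \<or> le v u"
      proof (intro ballI impI)
        fix u v assume uv: "u \<in> S" "v \<in> S" "e u = e v"
        have "d z \<noteq> card B" if "z \<in> S - K" for z
          using d that by auto
        then have "u \<in> K \<and> v \<in> K \<or> u \<in> S - K \<and> v \<in> S - K \<and> d u = d v"
          using uv by (auto simp: e_def split: if_splits)
        then show "le u v \<or> le v u"
          using chain' Kchain by blast
      qed
      ultimately show ?thesis
        by blast
    qed
  qed
qed

section \<open>From chains of vertices to Ferrers partitions\<close>

lemma bipartite_graph_commute: "bipartite_graph U V E \<longleftrightarrow> bipartite_graph V U E"
  unfolding bipartite_graph_def by (fastforce simp: insert_commute)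

text \<open>Carries the bound for \<open>U\<close> over to \<open>V\<close>: \<open>nbhd_le\<close>
  depends on \<open>E\<close> alone, so exchanging the sides affects nothing else.\<close>

lemma fp_commute: "fp U V E = fp V U E"
  by (simp add: fp_def ferrers_partition_def ferrers_graph_def bipartite_graph_commute[of U V])

lemma card_le_width:
  assumes "finite S" "antichain_on S le A"
  shows "card A \<le> width S le"
proof -
  have "{A. antichain_on S le A} \<subseteq> Pow S"
    by (auto simp: antichain_on_def)
  then have "finite {A. antichain_on S le A}"
    using assms(1) by (meson finite_Pow_iff finite_subset)
  then show ?thesis
    using assms(2) by (auto simp: width_def intro: Max_ge)
qed

text \<open>For disjoint edges \<open>{u, v}\<close> and \<open>{u', v'}\<close> with
  \<open>u\<close>, \<open>u'\<close> in \<open>C\<close>, say N(u) is contained in N(u'). Then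
  \<open>{u', v}\<close> is a third edge on the same four endpoints, and it belongs to the subgraph
  because it meets \<open>C\<close> in \<open>u'\<close>.\<close>

lemma chain_edges_ferrers:
  assumes G: "bipartite_graph U V E" and "C \<subseteq> U"
    and chain: "\<And>u u'. u \<in> C \<Longrightarrow> u' \<in> C \<Longrightarrow> nbhd_le E u u' \<or> nbhd_le E u' u"
  shows "ferrers_graph U V {e \<in> E. e \<inter> C \<noteq> {}}" (is "ferrers_graph U V ?F")
proof -
  have edge: "\<exists>u v. e = {u, v} \<and> u \<in> C \<and> v \<in> V \<and> v \<notin> C" if e: "e \<in> ?F" for e
  proof -
    obtain u v where "e = {u, v}" "u \<in> U" "v \<in> V"
      using G e unfolding bipartite_graph_def by blast
    moreover have "v \<notin> C"
      using G \<open>C \<subseteq> U\<close> \<open>v \<in> V\<close> by (auto simp: bipartite_graph_def)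
    ultimately show ?thesis
      using e by blast
  qed
  have swap: "\<exists>g\<in>?F. g \<subseteq> {u, v} \<union> {u', v'} \<and> g \<noteq> {u, v} \<and> g \<noteq> {u', v'}"
    if "{u, v} \<in> E" "u' \<in> C" "u \<noteq> u'" "v \<noteq> v'" "v \<notin> C" "nbhd_le E u u'" for u v u' v'
  proof (rule bexI)
    show "{u', v} \<in> ?F"
      using that by (auto simp: nbhd_le_def nbhd_def)
    show "{u', v} \<subseteq> {u, v} \<union> {u', v'} \<and> {u', v} \<noteq> {u, v} \<and> {u', v} \<noteq> {u', v'}"
      using that by (auto simp: doubleton_eq_iff)
  qed
  have "\<not> has_induced_2K2 ?F"
    unfolding has_induced_2K2_def
  proof clarify
    fix e f
    assume e: "e \<in> E" "e \<inter> C \<noteq> {}" and f: "f \<in> E" "f \<inter> C \<noteq> {}" and disj: "e \<inter> f = {}"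
      and only: "\<forall>g\<in>?F. g \<subseteq> e \<union> f \<longrightarrow> g = e \<or> g = f"
    obtain u v u' v' where uv: "e = {u, v}" "u \<in> C" "v \<notin> C" "f = {u', v'}" "u' \<in> C" "v' \<notin> C"
      using edge[of e] edge[of f] e f by blast
    then have ne: "u \<noteq> u'" "v \<noteq> v'"
      using disj by auto
    consider "nbhd_le E u u'" | "nbhd_le E u' u"
      using chain uv by blast
    then show False
    proof cases
      case 1
      then show False
        using swap[of u v u' v'] uv ne e only by blast
    next
      case 2
      then show False
        using swap[of u' v' u v, unfolded Un_commute[of "{u', v'}"]] uv ne f only by blast
    qed
  qed
  moreover have "bipartite_graph U V ?F"
    using G by (auto simp: bipartite_graph_def)
  ultimately show ?thesis
    by (simp add: ferrers_graph_def)
qed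

lemma fp_le_width:
  assumes G: "bipartite_graph U V E"
  shows "fp U V E \<le> width U (nbhd_le E)"
proof -
  have "finite U" "U \<inter> V = {}"
    using G by (auto simp: bipartite_graph_def)
  obtain A c where A: "antichain_on U (nbhd_le E) A" and c: "c ` U \<subseteq> {..<card A}"
    and chain: "\<forall>x\<in>U. \<forall>y\<in>U. c x = c y \<longrightarrow> nbhd_le E x y \<or> nbhd_le E y x"
    using dilworth[OF \<open>finite U\<close>, of "nbhd_le E"] unfolding nbhd_le_def by blast
  \<comment> \<open>Each edge is sorted by the colour of its end in \<open>U\<close>. This end is
    unique, so the parts cover \<open>E\<close> and are disjoint.\<close>
  define F where "F i = {e \<in> E. e \<inter> {u \<in> U. c u = i} \<noteq> {}}" for i
  have unique: "\<exists>u\<in>U. e \<inter> U = {u}" if e: "e \<in> E" for e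
  proof -
    obtain u v where "e = {u, v}" "u \<in> U" "v \<in> V"
      using G e unfolding bipartite_graph_def by blast
    then show ?thesis
      using \<open>U \<inter> V = {}\<close> by (intro bexI[of _ u]) auto
  qed
  have "(\<Union>i<card A. F i) = E"
  proof (intro subset_antisym subsetI)
    fix e assume "e \<in> E"
    then obtain u where "u \<in> U" "e \<inter> U = {u}"
      using unique by blast
    then have "e \<in> F (c u)" "c u < card A"
      using \<open>e \<in> E\<close> c by (auto simp: F_def)
    then show "e \<in> (\<Union>i<card A. F i)"
      by blast
  qed (auto simp: F_def)
  moreover have "disjoint_family_on F {..<card A}"
    unfolding disjoint_family_on_def
  proof (intro ballI impI equals0I)
    fix i j e assume ij: "i \<noteq> j" and "e \<in> F i \<inter> F j"
    then have "e \<in> E" and "i \<in> c ` (e \<inter> U)" "j \<in> c ` (e \<inter> U)"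
      by (auto simp: F_def)
    moreover obtain u where "e \<inter> U = {u}"
      using unique \<open>e \<in> E\<close> by blast
    ultimately show False
      using ij by simp
  qed
  moreover have "ferrers_graph U V (F i)" for i
    unfolding F_def by (rule chain_edges_ferrers[OF G]) (use chain in auto)
  ultimately have "ferrers_partition U V E (card A) F"
    by (simp add: ferrers_partition_def)
  then have "fp U V E \<le> card A"
    unfolding fp_def by (intro Least_le) blast
  also have "\<dots> \<le> width U (nbhd_le E)"
    using card_le_width[OF \<open>finite U\<close> A] .
  finally show ?thesis .
qed

theorem theorem4p2:
  fixes U V :: "'a set" and E :: "'a set set"
  assumes "bipartite_graph U V E"
  shows "fp U V E \<le> min (width U (nbhd_le E)) (width V (nbhd_le E))"
  using fp_le_width[OF assms] fp_le_width[of V U E] assms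
  by (simp add: fp_commute[of U V] bipartite_graph_commute[of U V])

end
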